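(* Let $P$ be a real polynomial of degree $m\in\mathbb{N}$, $m\ge1$. Then $$\int_0^{\frac{\pi}{2}}P(x)\log(\tan x)\,\mathrm{d}x=\sum_{k=1}^{\lfloor\frac{m+1}{2}\rfloor}\frac{(-1)^{k-1}}{2^{2k-1}}\left[P^{(2k-1)}\!\left(\tfrac{\pi}{2}\right)+P^{(2k-1)}(0)\right]\left(1-\frac{1}{2^{2k+1}}\right)\zeta(2k+1),$$ where $P^{(p)}(\alpha)$ denotes the $p$-th derivative of $P$ at $\alpha$.
   Context: $\zeta$ is the Riemann zeta function; $\lfloor\cdot\rfloor$ is the floor function. *)

theory Defs
  imports "HOL-Analysis.Analysis" "HOL-Computational_Algebra.Polynomial"
begin

text \<open>
  The Riemann zeta function at real arguments \<open>s > 1\<close>, given by its Dirichlet series. No analytic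
  continuation is set up: for \<open>s \<le> 1\<close> the series diverges and the value is unspecified.
\<close>

definition zeta :: "real \<Rightarrow> real" where
  "zeta s = (\<Sum>n. 1 / real (Suc n) powr s)"

lemma sums_zeta:
  assumes "s > 1"
  shows "(\<lambda>n. 1 / real (Suc n) powr s) sums zeta s"
proof -
  have "summable (\<lambda>n. real n powr (- s))"
    using assms by (simp add: summable_real_powr_iff)
  then have "summable (\<lambda>n. real (Suc n) powr (- s))"
    by (subst summable_Suc_iff)
  then show ?thesis
    unfolding zeta_def by (simp add: powr_minus_divide summable_sums)
qed

end

theory Submission
  imports Defs
begin

text \<open>
  On \<open>(0, \<pi>/2)\<close> one has the Fourier expansion \<open>ln (tan x) = - 2 \<Sum>\<^sub>N cos (2 N x) / N\<close> over odd \<open>N\<close>, locally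
  uniformly. Integrating it termwise \<open>k\<close> times, with cosines only (each integration shifts the phase
  by \<open>\<pi>/2\<close>), gives functions \<open>G\<^sub>k\<close> that for \<open>k > 0\<close> are continuous on the closed interval. Integration
  by parts shows that \<open>\<Sum>\<^sub>j (-1)\<^sup>j P\<^sup>(\<^sup>j\<^sup>) G\<^sub>j\<^sub>+\<^sub>1\<close> is an antiderivative of the integrand. At the end points
  the odd \<open>G\<^sub>k\<close> vanish and the even ones are multiples of \<open>\<Sum>\<^sub>N 1 / N\<^sup>k\<^sup>+\<^sup>1 = (1 - 2\<^sup>-\<^sup>k\<^sup>-\<^sup>1) \<zeta>(k + 1)\<close>.
\<close>

section \<open>Fourier series of \<open>ln (tan x)\<close> with an explicit error bound\<close>

text \<open>The product-to-sum formula turns each summand into a difference of cosines, so the sum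
  telescopes. At \<open>y = 2 * t\<close> this puts the derivative of the cosine sum in closed
  form.\<close>

lemma sum_sin_odd_multiples:
  fixes y :: real
  shows "2 * sin y * (\<Sum>j<N. sin (real (2 * j + 1) * y)) = 1 - cos (2 * real N * y)"
proof (induction N)
  case (Suc N)
  have "2 * sin y * sin (real (2 * N + 1) * y)
      = cos (real (2 * N + 1) * y - y) - cos (real (2 * N + 1) * y + y)"
    by (simp add: cos_diff cos_add)
  also have "\<dots> = cos (2 * real N * y) - cos (2 * real (Suc N) * y)"
    by (simp add: algebra_simps)
  finally show ?case
    using Suc by (simp add: distrib_left)
qed simp

text \<open>\<open>sin (2 * x)\<close> is symmetric about \<open>pi / 4\<close> and increasing
  before it. This keeps the denominators below away from 0.\<close>

lemma sin_double_ge: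
  fixes a x :: real
  assumes "0 < a" "a < x" "x < pi / 2 - a"
  shows "sin (2 * a) \<le> sin (2 * x)"
proof (cases "x \<le> pi / 4")
  case True
  then show ?thesis
    using assms by (intro sin_monotone_2pi_le) auto
next
  case False
  have "sin (2 * a) \<le> sin (pi - 2 * x)"
    using assms False by (intro sin_monotone_2pi_le) auto
  then show ?thesis by simp
qed

lemma ln_tan_has_derivative:
  assumes "0 < x" "x < pi / 2"
  shows "((\<lambda>x. ln (tan x)) has_real_derivative 2 / sin (2 * x)) (at x)"
proof -
  have pos: "sin x > 0" "cos x > 0"
    using assms by (auto intro: sin_gt_zero cos_gt_zero)
  then have "tan x > 0" by (simp add: tan_def)
  then have "((\<lambda>x. ln (tan x)) has_real_derivative inverse ((cos x)\<^sup>2) / tan x) (at x)"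
    using pos by (auto intro!: derivative_eq_intros simp: field_simps)
  moreover have "inverse ((cos x)\<^sup>2) / tan x = 2 / sin (2 * x)"
    using pos unfolding sin_double by (simp add: tan_def field_simps power2_eq_square)
  ultimately show ?thesis by simp
qed

text \<open>The bound is independent of \<open>x\<close> and tends to 0 in \<open>N\<close>, so it
  gives uniform convergence away from the end points.\<close>

lemma sum_cos_odd_multiples_approx:
  fixes a x :: real
  assumes a: "0 < a" "a < pi / 4" and x: "a < x" "x < pi / 2 - a" and N: "N > 0"
  shows "\<bar>(\<Sum>j<N. cos (2 * real (2 * j + 1) * x) / real (2 * j + 1)) + ln (tan x) / 2\<bar>
           \<le> 1 / (real N * (sin (2 * a))\<^sup>2)"
proof -
  \<comment> \<open>\<open>R\<close> is the boundary term obtained by integrating \<open>S' + 1 / sin (2 x) = cos (4 N x) / sin (2 x)\<close> by parts;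
    it leaves a remainder of order \<open>1 / N\<close>, and everything vanishes at \<open>\<pi>/4\<close>.\<close>
  define s where "s = sin (2 * a)"
  define S where "S = (\<lambda>x. \<Sum>j<N. cos (2 * real (2 * j + 1) * x) / real (2 * j + 1))"
  define R where "R = (\<lambda>x. sin (4 * real N * x) / (4 * real N * sin (2 * x)))"
  define D where "D = (\<lambda>x. S x + ln (tan x) / 2 - R x)"
  define D' where "D' = (\<lambda>x. cos (2 * x) * sin (4 * real N * x) / (2 * real N * (sin (2 * x))\<^sup>2))"
  have s: "0 < s" "s \<le> 1"
    using a by (auto simp: s_def intro: sin_gt_zero)
  have sin_ge: "s \<le> sin (2 * t)" if "t \<in> {a<..<pi / 2 - a}" for t
    using sin_double_ge[of a t] that a by (auto simp: s_def)
  have deriv: "(D has_real_derivative D' t) (at t)" if t: "t \<in> {a<..<pi / 2 - a}" for t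
  proof -
    have pos: "sin (2 * t) > 0"
      using sin_ge[OF t] s by linarith
    have "(S has_real_derivative (\<Sum>j<N. - 2 * sin (real (2 * j + 1) * (2 * t)))) (at t)"
      unfolding S_def
      by (auto intro!: derivative_eq_intros sum.cong simp: field_simps simp del: of_nat_add of_nat_Suc)
    moreover have "(\<Sum>j<N. - 2 * sin (real (2 * j + 1) * (2 * t)))
        = - (1 - cos (4 * real N * t)) / sin (2 * t)"
      using sum_sin_odd_multiples[of "2 * t" N] pos
      by (simp add: sum_negf flip: sum_distrib_left) (simp add: field_simps)
    ultimately have 1: "(S has_real_derivative - (1 - cos (4 * real N * t)) / sin (2 * t)) (at t)"
      by simp
    have 2: "((\<lambda>x. ln (tan x)) has_real_derivative 2 / sin (2 * t)) (at t)"
      using t a by (intro ln_tan_has_derivative) auto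
    have "(R has_real_derivative (cos (4 * real N * t) * (4 * real N) * (4 * real N * sin (2 * t))
        - sin (4 * real N * t) * (4 * real N * (cos (2 * t) * 2)))
        / (4 * real N * sin (2 * t) * (4 * real N * sin (2 * t)))) (at t)"
      unfolding R_def using pos N by (auto intro!: derivative_eq_intros)
    moreover have "(cos (4 * real N * t) * (4 * real N) * (4 * real N * sin (2 * t))
        - sin (4 * real N * t) * (4 * real N * (cos (2 * t) * 2)))
        / (4 * real N * sin (2 * t) * (4 * real N * sin (2 * t))) = cos (4 * real N * t) / sin (2 * t) - D' t"
      unfolding D'_def using pos N by (simp add: field_simps power2_eq_square)
    ultimately have 3: "(R has_real_derivative cos (4 * real N * t) / sin (2 * t) - D' t) (at t)"
      by simp
    have "(D has_real_derivative - (1 - cos (4 * real N * t)) / sin (2 * t) + (2 / sin (2 * t)) / 2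
        - (cos (4 * real N * t) / sin (2 * t) - D' t)) (at t)"
      unfolding D_def by (intro DERIV_diff DERIV_add DERIV_cdivide 1 2 3)
    moreover have "- (1 - cos (4 * real N * t)) / sin (2 * t) + (2 / sin (2 * t)) / 2
        - (cos (4 * real N * t) / sin (2 * t) - D' t) = D' t"
      using pos by (simp add: field_simps)
    ultimately show ?thesis by (simp only:)
  qed
  have bound: "norm (D' t) \<le> 1 / (2 * real N * s\<^sup>2)" if t: "t \<in> {a<..<pi / 2 - a}" for t
  proof -
    have "\<bar>cos (2 * t) * sin (4 * real N * t)\<bar> \<le> 1 * 1"
      unfolding abs_mult by (intro mult_mono) auto
    moreover have "s\<^sup>2 \<le> (sin (2 * t))\<^sup>2"
      using sin_ge[OF t] s by (intro power_mono) auto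
    ultimately show ?thesis
      unfolding D'_def real_norm_def abs_divide using s N
      by (intro frac_le) (auto simp: abs_mult)
  qed
  have "norm (D x - D (pi / 4)) \<le> 1 / (2 * real N * s\<^sup>2) * norm (x - pi / 4)"
    by (rule field_differentiable_bound[of "{a<..<pi / 2 - a}" D D'])
      (use x a in \<open>auto intro: has_field_derivative_at_within[OF deriv] bound[unfolded real_norm_def]\<close>)
  \<comment> \<open>The distance from \<open>x\<close> to \<open>pi / 4\<close> is less than
    \<open>pi / 4\<close>, hence less than 1.\<close>
  also have "\<dots> \<le> 1 / (2 * real N * s\<^sup>2) * 1"
    using x a pi_less_4 by (intro mult_left_mono) auto
  finally have D_le: "\<bar>D x - D (pi / 4)\<bar> \<le> 1 / (2 * real N * s\<^sup>2)" by simp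
  have "cos (2 * real (2 * j + 1) * (pi / 4)) = 0" for j
  proof -
    have "2 * real (2 * j + 1) * (pi / 4) = real j * pi + pi / 2"
      by (simp add: field_simps)
    then show ?thesis by (simp only: cos_add) simp
  qed
  then have "S (pi / 4) = 0"
    unfolding S_def by (simp del: of_nat_add of_nat_Suc)
  moreover have "R (pi / 4) = 0" "ln (tan (pi / 4)) = (0::real)"
    by (simp_all add: R_def tan_45)
  ultimately have "D (pi / 4) = 0" by (simp add: D_def)
  moreover have "\<bar>R x\<bar> \<le> 1 / (2 * real N * s\<^sup>2)"
  proof -
    \<comment> \<open>\<open>R\<close> costs only a factor \<open>1 / s\<close>; as
      \<open>s \<le> 1\<close>, it fits under the same bound as \<open>D\<close>.\<close>
    have "s\<^sup>2 \<le> s"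
      using s by (simp add: power2_eq_square mult_left_le)
    then have "2 * real N * s\<^sup>2 \<le> 2 * real N * (2 * sin (2 * x))"
      using sin_ge[of x] x s by (intro mult_left_mono) auto
    then show ?thesis
      unfolding R_def abs_divide using N s sin_ge[of x] x
      by (intro frac_le) (auto simp: abs_mult)
  qed
  moreover have "S x + ln (tan x) / 2 = D x + R x" by (simp add: D_def)
  ultimately have "\<bar>S x + ln (tan x) / 2\<bar> \<le> 1 / (2 * real N * s\<^sup>2) + 1 / (2 * real N * s\<^sup>2)"
    using D_le by linarith
  also have "\<dots> = 1 / (real N * s\<^sup>2)" using N s by (simp add: field_simps)
  finally show ?thesis by (simp add: S_def s_def)
qed

section \<open>Iterated antiderivatives of \<open>ln (tan x)\<close>\<close>

definition ln_tan_term :: "nat \<Rightarrow> nat \<Rightarrow> real \<Rightarrow> real" where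
  "ln_tan_term k n x = - 2 * cos (2 * real (2 * n + 1) * x - real k * (pi / 2))
     / (real (2 * n + 1) * (2 * real (2 * n + 1)) ^ k)"

text \<open>These are the functions \<open>G\<^sub>k\<close>. For \<open>k = 0\<close> the series
  diverges at 0 and \<open>pi / 2\<close>, where the value is unspecified; only interior points are
  considered then.\<close>

definition ln_tan_prim :: "nat \<Rightarrow> real \<Rightarrow> real" where
  "ln_tan_prim k x = (\<Sum>n. ln_tan_term k n x)"

lemma ln_tan_term_has_derivative:
  "(ln_tan_term (Suc k) n has_real_derivative ln_tan_term k n x) (at x within A)"
proof -
  define c where "c = 2 * real (2 * n + 1)"
  have c: "c > 0" by (simp add: c_def)
  have shift: "sin (c * x - real (Suc k) * (pi / 2)) = - cos (c * x - real k * (pi / 2))"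
  proof -
    have "c * x - real (Suc k) * (pi / 2) = (c * x - real k * (pi / 2)) - pi / 2"
      by (simp add: algebra_simps)
    then show ?thesis by (simp only: sin_diff) simp
  qed
  \<comment> \<open>The Fourier denominator is \<open>c / 2\<close>, so the whole denominator
    becomes a power of \<open>c\<close> and the constant 2 becomes 4.\<close>
  have eq: "ln_tan_term k n = (\<lambda>x. - 4 * cos (c * x - real k * (pi / 2)) / c ^ Suc k)" for k
    using c by (simp only: ln_tan_term_def fun_eq_iff flip: c_def) (simp add: c_def divide_simps)
  have "(ln_tan_term (Suc k) n has_real_derivative
      4 * (sin (c * x - real (Suc k) * (pi / 2)) * c) / c ^ Suc (Suc k)) (at x within A)"
    unfolding eq by (auto intro!: derivative_eq_intros)
  also have "4 * (sin (c * x - real (Suc k) * (pi / 2)) * c) / c ^ Suc (Suc k) = ln_tan_term k n x"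
    unfolding shift eq using c by simp
  finally show ?thesis .
qed

text \<open>One integration already makes the terms quadratically small, so the M-test works on any
  set. For \<open>k = 0\<close> the majorant would be harmonic, and the error bound above has to
  replace it.\<close>

lemma uniform_limit_ln_tan_prim:
  assumes "k > 0"
  shows "uniform_limit A (\<lambda>N x. \<Sum>n<N. ln_tan_term k n x) (ln_tan_prim k) sequentially"
  unfolding ln_tan_prim_def
proof (rule Weierstrass_m_test)
  show "norm (ln_tan_term k n x) \<le> 2 / real (Suc n) ^ 2" for n x
  proof -
    have "real (Suc n) ^ 2 \<le> real (2 * n + 1) * (2 * real (2 * n + 1)) ^ 1"
      unfolding power2_eq_square by (simp only: power_one_right, rule mult_mono) auto
    also have "\<dots> \<le> real (2 * n + 1) * (2 * real (2 * n + 1)) ^ k"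
      using assms by (intro mult_left_mono power_increasing) auto
    finally show ?thesis
      unfolding ln_tan_term_def real_norm_def abs_divide
      by (intro frac_le) (auto simp: abs_mult)
  qed
  have "summable (\<lambda>n. 2 * (1 / real n ^ 2))"
    by (intro summable_mult inverse_power_summable[of 2, simplified inverse_eq_divide power_one_over]) auto
  then show "summable (\<lambda>n. 2 / real (Suc n) ^ 2)"
    by (subst summable_Suc_iff) simp
qed

lemma uniform_limit_ln_tan:
  fixes a :: real
  assumes "0 < a" "a < pi / 4"
  shows "uniform_limit {a<..<pi / 2 - a} (\<lambda>N x. \<Sum>n<N. ln_tan_term 0 n x) (\<lambda>x. ln (tan x)) sequentially"
proof (rule uniform_limitI)
  fix e :: real
  assume e: "e > 0"
  define s where "s = sin (2 * a)"
  have s: "s > 0" using assms by (auto simp: s_def intro: sin_gt_zero)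
  have "(\<lambda>N. (2 / s\<^sup>2) * inverse (real N)) \<longlonglongrightarrow> (2 / s\<^sup>2) * 0"
    by (intro tendsto_intros lim_inverse_n)
  then have "\<forall>\<^sub>F N in sequentially. (2 / s\<^sup>2) * inverse (real N) < e"
    using e by (intro order_tendstoD(2)) auto
  then show "\<forall>\<^sub>F N in sequentially. \<forall>x\<in>{a<..<pi / 2 - a}.
      dist (\<Sum>n<N. ln_tan_term 0 n x) (ln (tan x)) < e"
    using eventually_gt_at_top[of 0]
  proof eventually_elim
    case (elim N)
    show ?case
    proof
      fix x assume x: "x \<in> {a<..<pi / 2 - a}"
      have scale: "\<bar>- 2 * u - ln (tan x)\<bar> = 2 * \<bar>u + ln (tan x) / 2\<bar>" for u :: real
        by (auto simp: abs_if)
      let ?S = "\<Sum>j<N. cos (2 * real (2 * j + 1) * x) / real (2 * j + 1)"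
      have "(\<Sum>n<N. ln_tan_term 0 n x) = - 2 * ?S"
        by (simp add: ln_tan_term_def sum_distrib_left del: of_nat_add of_nat_Suc)
      then have "dist (\<Sum>n<N. ln_tan_term 0 n x) (ln (tan x)) = 2 * \<bar>?S + ln (tan x) / 2\<bar>"
        using scale[of ?S] by (simp only: dist_real_def)
      also have "\<dots> \<le> 2 * (1 / (real N * s\<^sup>2))"
        using sum_cos_odd_multiples_approx[of a x N] x assms elim by (simp add: s_def)
      also have "\<dots> < e" using elim by (simp add: field_simps)
      finally show "dist (\<Sum>n<N. ln_tan_term 0 n x) (ln (tan x)) < e" .
    qed
  qed
qed

lemma ln_tan_interval:
  assumes "0 < x" "x < pi / 2"
  obtains a where "0 < a" "a < pi / 4" "x \<in> {a<..<pi / 2 - a}"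
proof
  let ?a = "min x (pi / 2 - x) / 2"
  show "0 < ?a" "?a < pi / 4" "x \<in> {?a<..<pi / 2 - ?a}"
    using assms by (auto simp: min_def field_simps)
qed

lemma ln_tan_prim_0:
  assumes "0 < x" "x < pi / 2"
  shows "ln_tan_prim 0 x = ln (tan x)"
proof -
  obtain a where a: "0 < a" "a < pi / 4" "x \<in> {a<..<pi / 2 - a}"
    using ln_tan_interval[OF assms] .
  then have "(\<lambda>N. \<Sum>n<N. ln_tan_term 0 n x) \<longlonglongrightarrow> ln (tan x)"
    using tendsto_uniform_limitI[OF uniform_limit_ln_tan] by blast
  then show ?thesis
    unfolding ln_tan_prim_def by (metis sums_def sums_unique)
qed

lemma sums_ln_tan_prim:
  assumes "k > 0"
  shows "(\<lambda>n. ln_tan_term k n x) sums ln_tan_prim k x"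
  unfolding sums_def
  using tendsto_uniform_limitI[OF uniform_limit_ln_tan_prim[OF assms, of UNIV]] by simp

lemma continuous_on_ln_tan_prim:
  assumes "k > 0"
  shows "continuous_on A (ln_tan_prim k)"
proof (rule uniform_limit_theorem[OF _ uniform_limit_ln_tan_prim[OF assms]])
  show "\<forall>\<^sub>F N in sequentially. continuous_on A (\<lambda>x. \<Sum>n<N. ln_tan_term k n x)"
    by (intro always_eventually allI) (auto simp: ln_tan_term_def intro!: continuous_intros)
qed simp

text \<open>Termwise differentiation needs uniform convergence of the differentiated series only
  near \<open>x\<close>, so an interval that avoids the end points suffices, also for
  \<open>k = 0\<close>.\<close>

lemma ln_tan_prim_has_derivative:
  assumes "0 < x" "x < pi / 2"
  shows "(ln_tan_prim (Suc k) has_real_derivative ln_tan_prim k x) (at x)"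
proof -
  obtain a where a: "0 < a" "a < pi / 4" and x: "x \<in> {a<..<pi / 2 - a}"
    using ln_tan_interval[OF assms] .
  let ?I = "{a<..<pi / 2 - a}"
  have "uniform_limit ?I (\<lambda>N x. \<Sum>n<N. ln_tan_term k n x) (ln_tan_prim k) sequentially"
  proof (cases "k = 0")
    case True
    have "uniform_limit ?I (\<lambda>N x. \<Sum>n<N. ln_tan_term 0 n x) (ln_tan_prim 0) sequentially
        \<longleftrightarrow> uniform_limit ?I (\<lambda>N x. \<Sum>n<N. ln_tan_term 0 n x) (\<lambda>x. ln (tan x)) sequentially"
      using a by (intro uniform_limit_cong') (auto intro: ln_tan_prim_0)
    then show ?thesis using uniform_limit_ln_tan[OF a] True by simp
  qed (simp add: uniform_limit_ln_tan_prim)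
  from has_field_derivative_series[OF _ ln_tan_term_has_derivative this x sums_summable[OF sums_ln_tan_prim]]
  have "\<exists>g. \<forall>y\<in>?I. (\<lambda>n. ln_tan_term (Suc k) n y) sums g y
      \<and> (g has_real_derivative ln_tan_prim k y) (at y within ?I)"
    by (simp only: convex_real_interval zero_less_Suc simp_thms)
  then obtain g where g: "\<And>y. y \<in> ?I \<Longrightarrow> (\<lambda>n. ln_tan_term (Suc k) n y) sums g y"
    "(g has_real_derivative ln_tan_prim k x) (at x within ?I)"
    using x by metis
  \<comment> \<open>The series theorem yields only some limit function \<open>g\<close>; uniqueness
    of sums identifies it.\<close>
  have eq: "g y = ln_tan_prim (Suc k) y" if "y \<in> ?I" for y
    by (rule sums_unique2[OF g(1)[OF that] sums_ln_tan_prim]) simp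
  have "(ln_tan_prim (Suc k) has_real_derivative ln_tan_prim k x) (at x within ?I)"
    by (rule has_field_derivative_transform_within[OF g(2) zero_less_one x eq])
  then show ?thesis
    by (simp only: at_within_open[OF x open_real_greaterThanLessThan])
qed

section \<open>Values at the end points\<close>

text \<open>The zeta series is grouped into consecutive pairs; the even member of each pair is
  \<open>1 / 2 powr s\<close> times a term of the same series and is subtracted.\<close>

lemma sums_zeta_odd:
  assumes "s > 1"
  shows "(\<lambda>n. 1 / real (2 * n + 1) powr s) sums ((1 - 1 / 2 powr s) * zeta s)"
proof -
  let ?f = "\<lambda>n. 1 / real (Suc n) powr s"
  have "(\<lambda>n. sum ?f {n * 2..<n * 2 + 2}) sums zeta s"
    using sums_group[OF sums_zeta[OF assms], of 2] by simp
  moreover have "(\<lambda>n. 1 / 2 powr s * ?f n) sums (1 / 2 powr s * zeta s)"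
    by (intro sums_mult sums_zeta assms)
  ultimately have "(\<lambda>n. sum ?f {n * 2..<n * 2 + 2} - 1 / 2 powr s * ?f n)
      sums (zeta s - 1 / 2 powr s * zeta s)"
    by (rule sums_diff)
  moreover have "sum ?f {n * 2..<n * 2 + 2} - 1 / 2 powr s * ?f n = 1 / real (2 * n + 1) powr s" for n
  proof -
    have "{n * 2..<n * 2 + 2} = {2 * n, 2 * n + 1}" by auto
    moreover have "real (Suc (2 * n + 1)) powr s = 2 powr s * real (Suc n) powr s"
      by (simp flip: powr_mult)
    ultimately show ?thesis by simp
  qed
  ultimately show ?thesis by (simp add: algebra_simps)
qed

lemma ln_tan_prim_at_0_even:
  assumes "k \<ge> 1"
  shows "ln_tan_prim (2 * k) 0
    = (-1) ^ (k - 1) / 2 ^ (2 * k - 1) * ((1 - 1 / 2 ^ (2 * k + 1)) * zeta (real (2 * k + 1)))"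
proof -
  obtain j where k: "k = Suc j"
    using assms by (cases k) auto
  \<comment> \<open>This is \<open>- 2 * (-1) ^ k / 2 ^ (2 * k)\<close>: the phase
    \<open>k * pi\<close> gives the sign, the \<open>2 * k\<close> integrations the power of
    2.\<close>
  let ?c = "(-1) ^ j / 2 ^ (2 * j + 1) :: real"
  have *: "(\<lambda>n. 1 / real (2 * n + 1) powr real (2 * k + 1))
      sums ((1 - 1 / 2 powr real (2 * k + 1)) * zeta (real (2 * k + 1)))"
    using k by (intro sums_zeta_odd) auto
  have "(\<lambda>n. ?c * (1 / real (2 * n + 1) ^ (2 * k + 1)))
      sums (?c * ((1 - 1 / 2 ^ (2 * k + 1)) * zeta (real (2 * k + 1))))"
    by (intro sums_mult) (use * in \<open>simp add: powr_realpow del: of_nat_add of_nat_Suc of_nat_mult\<close>)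
  moreover have "?c * (1 / real (2 * n + 1) ^ (2 * k + 1)) = ln_tan_term (2 * k) n 0" for n
  proof -
    have "cos (2 * real (2 * n + 1) * 0 - real (2 * k) * (pi / 2)) = (-1) ^ k"
      by simp
    then show ?thesis
      unfolding ln_tan_term_def k power_mult_distrib
      by (simp add: divide_simps del: of_nat_add of_nat_Suc of_nat_mult)
  qed
  ultimately show ?thesis
    using k sums_unique2 sums_ln_tan_prim[of "2 * k" 0] by fastforce
qed

lemma ln_tan_prim_at_0_odd:
  assumes "odd k"
  shows "ln_tan_prim k 0 = 0"
proof -
  obtain j where k: "k = 2 * j + 1" using assms by (elim oddE)
  have "real k * (pi / 2) = real j * pi + pi / 2"
    by (simp add: k field_simps)
  then have "cos (2 * real (2 * n + 1) * 0 - real k * (pi / 2)) = 0" for n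
    by (simp only: mult_zero_right diff_0 cos_minus) (simp add: cos_add)
  then show ?thesis
    unfolding ln_tan_prim_def ln_tan_term_def by simp
qed

text \<open>Moving from 0 to \<open>pi / 2\<close> shifts every cosine by an odd multiple of
  \<open>pi\<close>. This is why the two end points enter the final formula with a plus
  sign.\<close>

lemma ln_tan_prim_at_pi_half:
  assumes "k > 0"
  shows "ln_tan_prim k (pi / 2) = - ln_tan_prim k 0"
proof -
  have "ln_tan_term k n (pi / 2) = - ln_tan_term k n 0" for n
  proof -
    have "2 * real (2 * n + 1) * (pi / 2) - real k * (pi / 2)
        = (real (2 * n + 1) * pi) + (2 * real (2 * n + 1) * 0 - real k * (pi / 2))"
      by (simp add: algebra_simps)
    moreover have "sin (real (2 * n + 1) * pi) = 0" "cos (real (2 * n + 1) * pi) = - 1"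
      by (simp_all only: sin_npi cos_npi) simp
    ultimately show ?thesis
      unfolding ln_tan_term_def by (simp only: cos_add) simp
  qed
  then show ?thesis
    using sums_minus[OF sums_ln_tan_prim[OF assms, of 0]] sums_ln_tan_prim[OF assms, of "pi / 2"]
    by (simp add: sums_unique2)
qed

section \<open>Integration by parts and evaluation of the integral\<close>

lemma higher_pderiv_degree_less:
  fixes P :: "real poly"
  shows "degree P < n \<Longrightarrow> (pderiv ^^ n) P = 0"
by (intro poly_eqI) (simp add: coeff_higher_pderiv coeff_eq_0)

text \<open>By the product rule each summand yields two terms, and the alternating signs cancel
  neighbours. The remaining term carries the \<open>M\<close>-th derivative of \<open>P\<close>,
  which vanishes once \<open>M\<close> exceeds the degree.\<close>

lemma sum_by_parts_has_derivative:
  assumes G: "\<And>k. (G (Suc k) has_real_derivative G k x) (at x)"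
  shows "((\<lambda>x. \<Sum>j<M. (-1) ^ j * poly ((pderiv ^^ j) P) x * G (Suc j) x)
    has_real_derivative poly P x * G 0 x - (-1) ^ M * poly ((pderiv ^^ M) P) x * G M x) (at x)"
proof (induction M)
  case (Suc M)
  have "((\<lambda>x. (-1) ^ M * poly ((pderiv ^^ M) P) x * G (Suc M) x) has_real_derivative
      (-1) ^ M * poly ((pderiv ^^ Suc M) P) x * G (Suc M) x
      + (-1) ^ M * poly ((pderiv ^^ M) P) x * G M x) (at x)"
    by (rule derivative_eq_intros G poly_DERIV refl | simp)+
  from DERIV_add[OF Suc this] show ?case by (simp add: algebra_simps)
qed simp

theorem theorem2:
  fixes P :: "real poly" and m :: nat
  assumes "degree P = m" and "m \<ge> 1"
  shows "((\<lambda>x. poly P x * ln (tan x)) has_integral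
           (\<Sum>k = 1..nat \<lfloor>(real m + 1) / 2\<rfloor>.
              (-1) ^ (k - 1) / 2 ^ (2 * k - 1)
              * (poly ((pderiv ^^ (2 * k - 1)) P) (pi / 2) + poly ((pderiv ^^ (2 * k - 1)) P) 0)
              * (1 - 1 / 2 ^ (2 * k + 1)) * zeta (real (2 * k + 1))))
         {0..pi / 2}"
proof -
  define p where "p = (\<lambda>j. poly ((pderiv ^^ j) P))"
  define F where "F = (\<lambda>x. \<Sum>j<Suc m. (-1) ^ j * p j x * ln_tan_prim (Suc j) x)"
  have integral: "((\<lambda>x. poly P x * ln (tan x)) has_integral F (pi / 2) - F 0) {0..pi / 2}"
  \<comment> \<open>The logarithm is singular at both ends, but \<open>F\<close> involves only
    \<open>ln_tan_prim\<close> of positive index and is continuous up to them.\<close>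
  proof (rule fundamental_theorem_of_calculus_interior)
    show "continuous_on {0..pi / 2} F"
      unfolding F_def p_def by (intro continuous_intros continuous_on_ln_tan_prim) auto
    fix x :: real assume x: "x \<in> {0<..<pi / 2}"
    have "(pderiv ^^ Suc m) P = 0"
      using assms by (intro higher_pderiv_degree_less) auto
    then have "(F has_real_derivative poly P x * ln (tan x)) (at x)"
      using sum_by_parts_has_derivative[where G = ln_tan_prim and x = x and M = "Suc m" and P = P] x
      by (simp only: F_def p_def) (simp add: ln_tan_prim_has_derivative ln_tan_prim_0)
    then show "(F has_vector_derivative poly P x * ln (tan x)) (at x)"
      by (simp add: has_real_derivative_iff_has_vector_derivative)
  qed simp
  have "F (pi / 2) - F 0
      = (\<Sum>j<Suc m. (-1) ^ Suc j * (p j (pi / 2) + p j 0) * ln_tan_prim (Suc j) 0)"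
    unfolding F_def by (simp only: ln_tan_prim_at_pi_half zero_less_Suc flip: sum_subtractf)
      (simp only: power_Suc, intro sum.cong refl, algebra)
  \<comment> \<open>For even \<open>j\<close> the index \<open>Suc j\<close> is odd and the factor
    at 0 vanishes.\<close>
  also have "\<dots> = (\<Sum>j | j < Suc m \<and> odd j. (-1) ^ Suc j * (p j (pi / 2) + p j 0) * ln_tan_prim (Suc j) 0)"
    by (intro sum.mono_neutral_right) (auto simp: ln_tan_prim_at_0_odd)
  \<comment> \<open>Substituting \<open>j = 2 * k - 1\<close> makes the sign
    \<open>(-1) ^ Suc j\<close> equal to 1.\<close>
  also have "\<dots> = (\<Sum>k = 1..(m + 1) div 2. (p (2 * k - 1) (pi / 2) + p (2 * k - 1) 0) * ln_tan_prim (2 * k) 0)"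
  proof (rule sum.reindex_bij_witness[where i = "\<lambda>k. 2 * k - 1" and j = "\<lambda>j. Suc j div 2"])
    fix j assume "j \<in> {j. j < Suc m \<and> odd j}"
    then obtain i where i: "j = 2 * i + 1" "2 * i + 1 < Suc m"
      by (auto elim: oddE)
    then show "2 * (Suc j div 2) - 1 = j" "Suc j div 2 \<in> {1..(m + 1) div 2}"
      "(p (2 * (Suc j div 2) - 1) (pi / 2) + p (2 * (Suc j div 2) - 1) 0) * ln_tan_prim (2 * (Suc j div 2)) 0
        = (-1) ^ Suc j * (p j (pi / 2) + p j 0) * ln_tan_prim (Suc j) 0"
      by simp_all
  next
    fix k assume "k \<in> {1..(m + 1) div 2}"
    then have k: "1 \<le> k" "2 * k \<le> m + 1" by auto
    then show "Suc (2 * k - 1) div 2 = k" by simp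
    from k show "2 * k - 1 \<in> {j. j < Suc m \<and> odd j}" by auto
  qed
  also have "(m + 1) div 2 = nat \<lfloor>(real m + 1) / 2\<rfloor>"
    using floor_divide_of_nat_eq[of "m + 1" 2, where 'a = real] by (simp add: add.commute)
  finally have "F (pi / 2) - F 0 = (\<Sum>k = 1..nat \<lfloor>(real m + 1) / 2\<rfloor>.
      (p (2 * k - 1) (pi / 2) + p (2 * k - 1) 0) * ln_tan_prim (2 * k) 0)" .
  also have "\<dots> = (\<Sum>k = 1..nat \<lfloor>(real m + 1) / 2\<rfloor>.
      (-1) ^ (k - 1) / 2 ^ (2 * k - 1) * (p (2 * k - 1) (pi / 2) + p (2 * k - 1) 0)
      * (1 - 1 / 2 ^ (2 * k + 1)) * zeta (real (2 * k + 1)))"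
  proof (rule sum.cong)
    fix k assume "k \<in> {1..nat \<lfloor>(real m + 1) / 2\<rfloor>}"
    then have "k \<ge> 1" by simp
    from ln_tan_prim_at_0_even[OF this]
    show "(p (2 * k - 1) (pi / 2) + p (2 * k - 1) 0) * ln_tan_prim (2 * k) 0
        = (-1) ^ (k - 1) / 2 ^ (2 * k - 1) * (p (2 * k - 1) (pi / 2) + p (2 * k - 1) 0)
          * (1 - 1 / 2 ^ (2 * k + 1)) * zeta (real (2 * k + 1))"
      by (simp add: mult_ac)
  qed simp
  finally show ?thesis
    using integral by (simp only: p_def)
qed

end
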